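(* Assume, in addition to the standing assumptions listed in the context, that: (i) $P$ and $U$ are convex subsets of real vector spaces; (ii) $\lambda S(p_1,u_1) + (1-\lambda) S(p_2,u_2) \leq S(\lambda p_1 + (1-\lambda)p_2, \lambda u_1 + (1-\lambda)u_2)$ for all $p_1,p_2 \in P$, $u_1,u_2 \in U$, $\lambda \in [0,1]$; (iii) $\lambda \Phi(v_1) + (1-\lambda)\Phi(v_2) \leq \Phi(\lambda v_1 + (1-\lambda)v_2)$ for all $v_1,v_2 \in L^2_+(X)$ and $\lambda \in [0,1]$. Then, for all $u_1,u_2 \in U$ and all $\lambda \in [0,1]$, the maximal solutions of (F) satisfy \[ \lambda M(u_1) + (1-\lambda) M(u_2) \leq M(\lambda u_1 + (1-\lambda)u_2). \]
   Context: Standing assumptions and notation. $(X,\Sigma,\mu)$ is a complete measure space. $L^q(X)$ are the usual Lebesgue spaces, ordered by $v_1 \leq v_2 :\iff v_1 \leq v_2$ $\mu$-a.e. in $X$, and $L^q_+(X) := \{v \in L^q(X) \mid v \geq 0\}$. $\bar P$ is a set equipped with a partial order $\leq$, having at least two elements and a largest element $\bar p$; $P := \bar P \setminus \{\bar p\}$. $U$ is a nonempty set. $S\colon \bar P \times U \to L^2_+(X)$ satisfies $S(p_1,u) \leq S(p_2,u)$ for all $u \in U$ and $p_1,p_2 \in \bar P$ with $p_1 \leq p_2$. $\Phi\colon L^2(X) \to P$ satisfies $\Phi(v_1) \leq \Phi(v_2)$ for all $v_1,v_2 \in L^2(X)$ with $v_1 \leq v_2$. For $u \in U$, problem (F) with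 parameter $u$ is: find $y \in L^2(X)$ with $y = S(\Phi(y),u)$. Under the standing assumptions, for every $u \in U$ the solution set of (F) is nonempty and possesses a unique largest element $M(u)$ (the maximal solution); moreover every $v\in L^2(X)$ with $v\le S(\Phi(v),u)$ satisfies $v\le M(u)$. *)

theory Defs
  imports "HOL-Analysis.Analysis"
begin

text \<open>Elements of L2 are equivalence classes of square integrable real functions under equality
  almost everywhere. The order and linear combinations are lifted from representatives; the choice of
  these does not matter by the lemmas \<open>L2_le_class_iff\<close> and \<open>L2_lincomb_class\<close> below.\<close>

definition L2_fun :: "'x measure \<Rightarrow> ('x \<Rightarrow> real) set" where
  "L2_fun M = {f \<in> borel_measurable M. integrable M (\<lambda>x. (f x)\<^sup>2)}"

definition ae_eq :: "'x measure \<Rightarrow> (('x \<Rightarrow> real) \<times> ('x \<Rightarrow> real)) set" where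
  "ae_eq M = {(f, g). f \<in> L2_fun M \<and> g \<in> L2_fun M \<and> (AE x in M. f x = g x)}"

definition L2 :: "'x measure \<Rightarrow> ('x \<Rightarrow> real) set set" where
  "L2 M = L2_fun M // ae_eq M"

definition L2_class :: "'x measure \<Rightarrow> ('x \<Rightarrow> real) \<Rightarrow> ('x \<Rightarrow> real) set" where
  "L2_class M f = ae_eq M `` {f}"

definition L2_le :: "'x measure \<Rightarrow> ('x \<Rightarrow> real) set \<Rightarrow> ('x \<Rightarrow> real) set \<Rightarrow> bool" where
  "L2_le M v w \<longleftrightarrow> (\<exists>f\<in>v. \<exists>g\<in>w. AE x in M. f x \<le> g x)"

definition L2_lincomb ::
    "'x measure \<Rightarrow> real \<Rightarrow> ('x \<Rightarrow> real) set \<Rightarrow> real \<Rightarrow> ('x \<Rightarrow> real) set \<Rightarrow> ('x \<Rightarrow> real) set" where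
  "L2_lincomb M a v b w = (\<Union>f\<in>v. \<Union>g\<in>w. L2_class M (\<lambda>x. a * f x + b * g x))"

definition L2_nonneg :: "'x measure \<Rightarrow> ('x \<Rightarrow> real) set set" where
  "L2_nonneg M = {v \<in> L2 M. L2_le M (L2_class M (\<lambda>_. 0)) v}"

lemma equiv_ae_eq: "equiv (L2_fun M) (ae_eq M)"
proof (rule equivI)
  show "ae_eq M \<subseteq> L2_fun M \<times> L2_fun M"
    by (auto simp: ae_eq_def)
  show "refl_on (L2_fun M) (ae_eq M)"
    by (auto simp: refl_on_def ae_eq_def)
  show "sym (ae_eq M)"
    by (auto simp: sym_def ae_eq_def)
  show "trans (ae_eq M)"
    by (auto simp: trans_def ae_eq_def)
qed

lemma L2_class_eq_iff:
  assumes "f \<in> L2_fun M" "g \<in> L2_fun M"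
  shows "L2_class M f = L2_class M g \<longleftrightarrow> (AE x in M. f x = g x)"
  unfolding L2_class_def using assms
  by (subst eq_equiv_class_iff[OF equiv_ae_eq]) (auto simp: ae_eq_def)

lemma L2_le_class_iff:
  assumes "f \<in> L2_fun M" "g \<in> L2_fun M"
  shows "L2_le M (L2_class M f) (L2_class M g) \<longleftrightarrow> (AE x in M. f x \<le> g x)"
proof
  assume "L2_le M (L2_class M f) (L2_class M g)"
  then obtain f' g' where "AE x in M. f x = f' x" "AE x in M. g x = g' x" "AE x in M. f' x \<le> g' x"
    by (auto simp: L2_le_def L2_class_def ae_eq_def)
  then show "AE x in M. f x \<le> g x"
    by eventually_elim simp
next
  assume "AE x in M. f x \<le> g x"
  with assms show "L2_le M (L2_class M f) (L2_class M g)"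
    by (auto simp: L2_le_def L2_class_def ae_eq_def)
qed

lemma L2_fun_lincomb:
  assumes "f \<in> L2_fun M" "g \<in> L2_fun M"
  shows "(\<lambda>x. a * f x + b * g x) \<in> L2_fun M"
proof -
  have [measurable]: "f \<in> borel_measurable M" "g \<in> borel_measurable M"
    and int: "integrable M (\<lambda>x. (f x)\<^sup>2)" "integrable M (\<lambda>x. (g x)\<^sup>2)"
    using assms by (auto simp: L2_fun_def)
  have "integrable M (\<lambda>x. (a * f x + b * g x)\<^sup>2)"
  proof (rule Bochner_Integration.integrable_bound)
    show "integrable M (\<lambda>x. 2 * a\<^sup>2 * (f x)\<^sup>2 + 2 * b\<^sup>2 * (g x)\<^sup>2)"
      using int by simp
    have "(a * s + b * t)\<^sup>2 \<le> 2 * a\<^sup>2 * s\<^sup>2 + 2 * b\<^sup>2 * t\<^sup>2" for s t :: real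
      using zero_le_power2[of "a * s - b * t"] by (simp add: power2_eq_square algebra_simps)
    then show "AE x in M. norm ((a * f x + b * g x)\<^sup>2) \<le> norm (2 * a\<^sup>2 * (f x)\<^sup>2 + 2 * b\<^sup>2 * (g x)\<^sup>2)"
      by (intro AE_I2) (simp add: order_trans[OF _ abs_ge_self])
  qed measurable
  then show ?thesis
    by (simp add: L2_fun_def)
qed

lemma L2_lincomb_class:
  assumes f: "f \<in> L2_fun M" and g: "g \<in> L2_fun M"
  shows "L2_lincomb M a (L2_class M f) b (L2_class M g) = L2_class M (\<lambda>x. a * f x + b * g x)"
proof -
  have "L2_class M (\<lambda>x. a * f' x + b * g' x) = L2_class M (\<lambda>x. a * f x + b * g x)"
    if "f' \<in> L2_class M f" "g' \<in> L2_class M g" for f' g'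
  proof -
    have f': "f' \<in> L2_fun M" and g': "g' \<in> L2_fun M"
      and ae: "AE x in M. f x = f' x" "AE x in M. g x = g' x"
      using that by (auto simp: L2_class_def ae_eq_def)
    from ae have "AE x in M. a * f' x + b * g' x = a * f x + b * g x"
      by eventually_elim simp
    with f g f' g' show ?thesis
      by (simp add: L2_class_eq_iff L2_fun_lincomb)
  qed
  moreover have "f \<in> L2_class M f" "g \<in> L2_class M g"
    using f g by (auto simp: L2_class_def ae_eq_def)
  ultimately show ?thesis
    unfolding L2_lincomb_def by blast
qed

text \<open>The partial order on \<open>Pbar\<close> is the set \<open>leP\<close> of pairs \<open>(p, q)\<close> with \<open>p \<le> q\<close>.\<close>

locale qvi_setting = complete_measure M
  for M :: "'x measure" +
  fixes Pbar :: "'p set" and leP :: "'p rel" and pbar :: 'p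
    and U :: "'u set"
    and S :: "'p \<Rightarrow> 'u \<Rightarrow> ('x \<Rightarrow> real) set"
    and \<Phi> :: "('x \<Rightarrow> real) set \<Rightarrow> 'p"
  assumes partial_order: "partial_order_on Pbar leP"
    and two_elements: "\<exists>p\<in>Pbar. \<exists>q\<in>Pbar. p \<noteq> q"
    and pbar_in: "pbar \<in> Pbar"
    and pbar_largest: "\<And>p. p \<in> Pbar \<Longrightarrow> (p, pbar) \<in> leP"
    and U_nonempty: "U \<noteq> {}"
    and S_in: "\<And>p u. p \<in> Pbar \<Longrightarrow> u \<in> U \<Longrightarrow> S p u \<in> L2_nonneg M"
    and S_mono: "\<And>p1 p2 u. p1 \<in> Pbar \<Longrightarrow> p2 \<in> Pbar \<Longrightarrow> u \<in> U \<Longrightarrow> (p1, p2) \<in> leP \<Longrightarrow>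
      L2_le M (S p1 u) (S p2 u)"
    and Phi_in: "\<And>v. v \<in> L2 M \<Longrightarrow> \<Phi> v \<in> Pbar - {pbar}"
    and Phi_mono: "\<And>v1 v2. v1 \<in> L2 M \<Longrightarrow> v2 \<in> L2 M \<Longrightarrow> L2_le M v1 v2 \<Longrightarrow> (\<Phi> v1, \<Phi> v2) \<in> leP"

text \<open>The fixed points \<open>y = S (\<Phi> y) u\<close> in L2 and the largest one of them, which exists and is unique in
  \<open>qvi_setting\<close> for every \<open>u \<in> U\<close>.\<close>

definition F_solutions ::
    "'x measure \<Rightarrow> ('p \<Rightarrow> 'u \<Rightarrow> ('x \<Rightarrow> real) set) \<Rightarrow> (('x \<Rightarrow> real) set \<Rightarrow> 'p) \<Rightarrow> 'u \<Rightarrow>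
      ('x \<Rightarrow> real) set set" where
  "F_solutions M S \<Phi> u = {y \<in> L2 M. y = S (\<Phi> y) u}"

definition F_max_solution ::
    "'x measure \<Rightarrow> ('p \<Rightarrow> 'u \<Rightarrow> ('x \<Rightarrow> real) set) \<Rightarrow> (('x \<Rightarrow> real) set \<Rightarrow> 'p) \<Rightarrow> 'u \<Rightarrow>
      ('x \<Rightarrow> real) set" where
  "F_max_solution M S \<Phi> u =
    (THE y. y \<in> F_solutions M S \<Phi> u \<and> (\<forall>z\<in>F_solutions M S \<Phi> u. L2_le M z y))"

text \<open>The largest element of \<open>Pbar\<close> need not belong to the vector space containing
  \<open>P = Pbar - {pbar}\<close> (it may be a point at infinity). Therefore \<open>P\<close> is a subset of a vector space by
  means of a map \<open>\<iota>\<close>, injective on \<open>P\<close>, that identifies \<open>P\<close> with \<open>\<iota> ` P\<close>; if \<open>P\<close> literally consists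
  of vectors, \<open>\<iota>\<close> is the identity. The following is the element \<open>a p + b q\<close> of \<open>P\<close> under this
  identification; it is meaningful if \<open>a *\<^sub>R \<iota> p + b *\<^sub>R \<iota> q\<close> lies in \<open>\<iota> ` P\<close>.\<close>

definition lincomb_in ::
    "'p set \<Rightarrow> ('p \<Rightarrow> 'v::real_vector) \<Rightarrow> real \<Rightarrow> 'p \<Rightarrow> real \<Rightarrow> 'p \<Rightarrow> 'p" where
  "lincomb_in P \<iota> a p b q = inv_into P \<iota> (a *\<^sub>R \<iota> p + b *\<^sub>R \<iota> q)"

end

theory Submission
  imports Defs
begin

text \<open>The maximal solution \<open>F_max_solution M S \<Phi> u\<close> is not only the largest fixed point of the increasing
  map \<open>T v = S (\<Phi> v) u\<close>, it is also the largest subsolution: \<open>v \<le> T v\<close> already implies that \<open>v\<close> lies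
  below it. Given this, concavity is immediate. Let \<open>y\<close> be the convex combination of the maximal
  solutions for \<open>u1\<close> and \<open>u2\<close>. Joint concavity of \<open>S\<close>, concavity of \<open>\<Phi>\<close> and monotonicity of \<open>S\<close> in its
  first argument show that \<open>y\<close> is a subsolution for the convex combination of \<open>u1\<close> and \<open>u2\<close>, hence \<open>y\<close>
  lies below the maximal solution there.

  The characterization by subsolutions (\<open>F_max_solution_greatest_subsolution\<close>) is the argument of
  Knaster and Tarski. The subsolutions contain \<open>0\<close> because \<open>S\<close> is nonnegative, they are bounded above
  by \<open>S pbar u\<close>, and they are closed under binary maxima because \<open>T\<close> is increasing. If \<open>m\<close> is their
  supremum, then \<open>T m\<close> is an upper bound of them, so \<open>m \<le> T m\<close>; therefore \<open>T m\<close> is again a subsolution,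
  so \<open>T m \<le> m\<close>.

  The supremum exists because L2 is Dedekind complete over an arbitrary measure space. Pointwise
  suprema of uncountable families need not be measurable, but a sequence whose squared distances to
  an upper bound approach their infimum already exhausts the family
  (\<open>L2_fun_bounded_max_closed_has_lub\<close>).\<close>

section \<open>Suprema in L2\<close>

lemma L2_fun_measurable: "f \<in> L2_fun M \<Longrightarrow> f \<in> borel_measurable M"
  by (simp add: L2_fun_def)

lemma L2_fun_diff:
  assumes "f \<in> L2_fun M" "g \<in> L2_fun M"
  shows "(\<lambda>x. f x - g x) \<in> L2_fun M"
  using L2_fun_lincomb[OF assms, of 1 "-1"] by simp

lemma L2_fun_between:
  assumes f: "f \<in> L2_fun M" and h: "h \<in> L2_fun M"
    and g: "g \<in> borel_measurable M" and ae: "AE x in M. f x \<le> g x \<and> g x \<le> h x"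
  shows "g \<in> L2_fun M"
proof -
  have [measurable]: "g \<in> borel_measurable M"
    by (rule g)
  have "integrable M (\<lambda>x. (g x)\<^sup>2)"
  proof (rule Bochner_Integration.integrable_bound)
    show "integrable M (\<lambda>x. (f x)\<^sup>2 + (h x)\<^sup>2)"
      using f h by (simp add: L2_fun_def)
    have sq_le: "c\<^sup>2 \<le> a\<^sup>2 + b\<^sup>2" if "a \<le> c" "c \<le> b" for a b c :: real
    proof (cases "c \<ge> 0")
      case True
      then have "c\<^sup>2 \<le> b\<^sup>2" using that by (intro power_mono) auto
      then show ?thesis by (simp add: add_increasing)
    next
      case False
      then have "(- c)\<^sup>2 \<le> (- a)\<^sup>2" using that by (intro power_mono) auto
      then show ?thesis by (simp add: add_increasing2)
    qed
    show "AE x in M. norm ((g x)\<^sup>2) \<le> norm ((f x)\<^sup>2 + (h x)\<^sup>2)"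
      using ae by eventually_elim (simp add: sq_le)
  qed measurable
  then show ?thesis
    using g by (simp add: L2_fun_def)
qed

lemma L2_fun_max:
  assumes f: "f \<in> L2_fun M" and g: "g \<in> L2_fun M"
  shows "(\<lambda>x. max (f x) (g x)) \<in> L2_fun M"
proof -
  have [measurable]: "f \<in> borel_measurable M" "g \<in> borel_measurable M"
    using f g by (auto dest: L2_fun_measurable)
  have "integrable M (\<lambda>x. (max (f x) (g x))\<^sup>2)"
  proof (rule Bochner_Integration.integrable_bound)
    show "integrable M (\<lambda>x. (f x)\<^sup>2 + (g x)\<^sup>2)"
      using f g by (simp add: L2_fun_def)
    show "AE x in M. norm ((max (f x) (g x))\<^sup>2) \<le> norm ((f x)\<^sup>2 + (g x)\<^sup>2)"
      by (intro AE_I2) (simp add: max_def)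
  qed measurable
  then show ?thesis
    by (simp add: L2_fun_def)
qed

text \<open>For \<open>s \<le> r \<le> b\<close> one has \<open>(r - s)\<^sup>2 \<le> (b - s)\<^sup>2 - (b - r)\<^sup>2\<close>, so raising \<open>f\<close> to \<open>max f g\<close> lowers the
  squared distance to \<open>b\<close> by at least the squared norm of the positive part of \<open>g - f\<close>. Along a
  sequence that minimizes this distance over a family closed under maxima, these positive parts
  therefore tend to zero for every member \<open>g\<close>; hence the countable supremum of the sequence dominates
  all of the family.\<close>

lemma L2_fun_bounded_max_closed_has_lub:
  assumes F: "F \<subseteq> L2_fun M" "F \<noteq> {}"
    and max_closed: "\<And>f g. f \<in> F \<Longrightarrow> g \<in> F \<Longrightarrow> (\<lambda>x. max (f x) (g x)) \<in> F"
    and b: "b \<in> L2_fun M" and ub: "\<And>f. f \<in> F \<Longrightarrow> AE x in M. f x \<le> b x"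
  shows "\<exists>m\<in>L2_fun M. (\<forall>f\<in>F. AE x in M. f x \<le> m x) \<and>
    (\<forall>c. (\<forall>f\<in>F. AE x in M. f x \<le> c x) \<longrightarrow> (AE x in M. m x \<le> c x))"
proof -
  define J where "J f = (\<integral>x. (b x - f x)\<^sup>2 \<partial>M)" for f
  have int_sq: "integrable M (\<lambda>x. (f x - g x)\<^sup>2)" if "f \<in> L2_fun M" "g \<in> L2_fun M" for f g
    using L2_fun_diff[OF that] by (simp add: L2_fun_def)
  have bdd: "bdd_below (J ` F)"
    by (rule bdd_belowI2[of _ 0]) (simp add: J_def)
  have "\<exists>f\<in>F. J f < Inf (J ` F) + 1 / real (Suc n)" for n
    using cINF_less_iff[OF F(2) bdd, of "Inf (J ` F) + 1 / real (Suc n)"] by simp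
  then obtain f where f: "\<And>n. f n \<in> F" "\<And>n. J (f n) < Inf (J ` F) + 1 / real (Suc n)"
    by metis
  have fL: "f n \<in> L2_fun M" for n
    using f(1) F(1) by auto
  have [measurable]: "f n \<in> borel_measurable M" "b \<in> borel_measurable M" for n
    using fL b by (auto dest: L2_fun_measurable)
  (* Truncating at b changes f n on a null set only and makes the supremum finite everywhere. *)
  define m where "m x = (SUP n. min (f n x) (b x))" for x
  have bddm: "bdd_above (range (\<lambda>n. min (f n x) (b x)))" for x
    by (rule bdd_aboveI2[of _ _ "b x"]) simp
  have m_ge: "min (f n x) (b x) \<le> m x" for n x
    unfolding m_def by (rule cSUP_upper[OF _ bddm]) simp
  have m_meas [measurable]: "m \<in> borel_measurable M"
    unfolding m_def[abs_def] by (rule borel_measurable_cSUP) (use bddm in auto)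
  have f_le_b: "AE x in M. f n x \<le> b x" for n
    by (rule ub[OF f(1)])
  have f_le_m: "AE x in M. f n x \<le> m x" for n
    using f_le_b[of n] by eventually_elim (metis m_ge min.absorb1)
  have m_le_b: "m x \<le> b x" for x
    unfolding m_def by (rule cSUP_least) auto
  have mL: "m \<in> L2_fun M"
    by (rule L2_fun_between[OF fL[of 0] b m_meas])
      (use f_le_m[of 0] in \<open>eventually_elim; simp add: m_le_b\<close>)
  have "AE x in M. g x \<le> m x" if g: "g \<in> F" for g
  proof -
    have gL: "g \<in> L2_fun M"
      using g F(1) by auto
    have intp: "integrable M (\<lambda>x. (max (g x) (m x) - m x)\<^sup>2)"
      by (rule int_sq[OF L2_fun_max[OF gL mL] mL])
    have "(\<integral>x. (max (g x) (m x) - m x)\<^sup>2 \<partial>M) \<le> 1 / real (Suc n)" for n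
    proof -
      let ?w = "\<lambda>x. max (f n x) (g x)"
      have w: "?w \<in> F" "?w \<in> L2_fun M"
        using max_closed[OF f(1) g] F(1) by auto
      have pointwise: "(max s q - q)\<^sup>2 \<le> (c - r)\<^sup>2 - (c - max r s)\<^sup>2"
        if "r \<le> q" "r \<le> c" "s \<le> c" for q r s c :: real
      proof -
        have "(max s q - q)\<^sup>2 \<le> (max r s - r)\<^sup>2"
          using that by (intro power_mono) auto
        also have "\<dots> \<le> (max r s - r)\<^sup>2 + 2 * ((c - max r s) * (max r s - r))"
          using that by simp
        also have "\<dots> = (c - r)\<^sup>2 - (c - max r s)\<^sup>2"
          by (simp add: power2_eq_square algebra_simps)
        finally show ?thesis .
      qed
      have "(\<integral>x. (max (g x) (m x) - m x)\<^sup>2 \<partial>M) \<le> (\<integral>x. (b x - f n x)\<^sup>2 - (b x - ?w x)\<^sup>2 \<partial>M)"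
      proof (rule integral_mono_AE[OF intp])
        show "integrable M (\<lambda>x. (b x - f n x)\<^sup>2 - (b x - ?w x)\<^sup>2)"
          using int_sq[OF b fL] int_sq[OF b w(2)] by (rule Bochner_Integration.integrable_diff)
        show "AE x in M. (max (g x) (m x) - m x)\<^sup>2 \<le> (b x - f n x)\<^sup>2 - (b x - ?w x)\<^sup>2"
          using f_le_m[of n] f_le_b[of n] ub[OF g] by eventually_elim (rule pointwise)
      qed
      also have "\<dots> = J (f n) - J ?w"
        unfolding J_def using int_sq[OF b fL] int_sq[OF b w(2)]
        by (rule Bochner_Integration.integral_diff)
      also have "\<dots> \<le> 1 / real (Suc n)"
        using f(2)[of n] cINF_lower[OF bdd w(1)] by simp
      finally show ?thesis .
    qed
    then have "(\<integral>x. (max (g x) (m x) - m x)\<^sup>2 \<partial>M) \<le> 0"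
      by (intro LIMSEQ_le_const[OF LIMSEQ_inverse_real_of_nat]) (auto simp: inverse_eq_divide)
    then have "(\<integral>x. (max (g x) (m x) - m x)\<^sup>2 \<partial>M) = 0"
      by (intro antisym) auto
    then have "AE x in M. (max (g x) (m x) - m x)\<^sup>2 = 0"
      using integral_nonneg_eq_0_iff_AE[OF intp] by simp
    then show ?thesis
      by eventually_elim (simp add: max_def split: if_splits)
  qed
  moreover have "AE x in M. m x \<le> c x" if "\<forall>f\<in>F. AE x in M. f x \<le> c x" for c
  proof -
    have "AE x in M. \<forall>n. f n x \<le> c x"
      using that f(1) by (simp add: AE_all_countable)
    then show ?thesis
      by eventually_elim (auto simp: m_def intro!: cSUP_least min.coboundedI1)
  qed
  ultimately show ?thesis
    using mL by blast
qed

section \<open>The order on L2\<close>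

lemma L2_class_in_L2: "f \<in> L2_fun M \<Longrightarrow> L2_class M f \<in> L2 M"
  by (simp add: L2_def L2_class_def quotientI)

lemma L2_cases:
  assumes "v \<in> L2 M"
  obtains f where "f \<in> L2_fun M" "v = L2_class M f"
  using assms by (auto simp: L2_def L2_class_def elim: quotientE)

lemma L2_le_antisym:
  assumes "v \<in> L2 M" "w \<in> L2 M" "L2_le M v w" "L2_le M w v"
  shows "v = w"
proof -
  obtain f g where fg: "f \<in> L2_fun M" "v = L2_class M f" "g \<in> L2_fun M" "w = L2_class M g"
    using assms(1,2) by (metis L2_cases)
  then have "AE x in M. f x \<le> g x" "AE x in M. g x \<le> f x"
    using assms(3,4) by (simp_all add: L2_le_class_iff)
  then have "AE x in M. f x = g x"
    by eventually_elim simp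
  then show ?thesis
    using fg by (simp add: L2_class_eq_iff)
qed

lemma L2_le_trans:
  assumes "v \<in> L2 M" "w \<in> L2 M" "z \<in> L2 M" "L2_le M v w" "L2_le M w z"
  shows "L2_le M v z"
proof -
  obtain f g h where fgh: "f \<in> L2_fun M" "v = L2_class M f" "g \<in> L2_fun M" "w = L2_class M g"
    "h \<in> L2_fun M" "z = L2_class M h"
    using assms(1-3) by (metis L2_cases)
  then have "AE x in M. f x \<le> g x" "AE x in M. g x \<le> h x"
    using assms(4,5) by (simp_all add: L2_le_class_iff)
  then have "AE x in M. f x \<le> h x"
    by eventually_elim simp
  then show ?thesis
    using fgh by (simp add: L2_le_class_iff)
qed

lemma L2_le_refl: "v \<in> L2 M \<Longrightarrow> L2_le M v v"
  by (metis L2_cases L2_le_class_iff AE_I2 order_refl)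

lemma L2_lincomb_in_L2:
  assumes "v \<in> L2 M" "w \<in> L2 M"
  shows "L2_lincomb M a v b w \<in> L2 M"
proof -
  obtain f g where "f \<in> L2_fun M" "v = L2_class M f" "g \<in> L2_fun M" "w = L2_class M g"
    using assms by (metis L2_cases)
  then show ?thesis
    by (simp add: L2_lincomb_class L2_fun_lincomb L2_class_in_L2)
qed

lemma L2_bounded_max_closed_has_lub:
  assumes A: "A \<subseteq> L2 M" "A \<noteq> {}"
    and max_closed: "\<And>f g. f \<in> L2_fun M \<Longrightarrow> g \<in> L2_fun M \<Longrightarrow> L2_class M f \<in> A \<Longrightarrow>
      L2_class M g \<in> A \<Longrightarrow> L2_class M (\<lambda>x. max (f x) (g x)) \<in> A"
    and b: "b \<in> L2 M" and ub: "\<And>v. v \<in> A \<Longrightarrow> L2_le M v b"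
  shows "\<exists>m\<in>L2 M. (\<forall>v\<in>A. L2_le M v m) \<and>
    (\<forall>c\<in>L2 M. (\<forall>v\<in>A. L2_le M v c) \<longrightarrow> L2_le M m c)"
proof -
  define F where "F = {f \<in> L2_fun M. L2_class M f \<in> A}"
  have A_eq: "A = L2_class M ` F"
  proof
    show "A \<subseteq> L2_class M ` F"
    proof
      fix v assume v: "v \<in> A"
      then obtain f where "f \<in> L2_fun M" "v = L2_class M f"
        using A(1) by (blast elim: L2_cases)
      then show "v \<in> L2_class M ` F"
        using v by (simp add: F_def)
    qed
  qed (auto simp: F_def)
  obtain h where h: "h \<in> L2_fun M" "b = L2_class M h"
    using b by (rule L2_cases)
  have "\<exists>m\<in>L2_fun M. (\<forall>f\<in>F. AE x in M. f x \<le> m x) \<and>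
    (\<forall>c. (\<forall>f\<in>F. AE x in M. f x \<le> c x) \<longrightarrow> (AE x in M. m x \<le> c x))"
  proof (rule L2_fun_bounded_max_closed_has_lub)
    show "F \<subseteq> L2_fun M"
      by (auto simp: F_def)
    show "F \<noteq> {}"
      using A(2) unfolding A_eq by simp
    show "(\<lambda>x. max (f x) (g x)) \<in> F" if "f \<in> F" "g \<in> F" for f g
      using that max_closed L2_fun_max by (auto simp: F_def)
    show "AE x in M. f x \<le> h x" if "f \<in> F" for f
      using that ub[of "L2_class M f"] h by (auto simp: F_def L2_le_class_iff)
  qed (rule h(1))
  then obtain m where m: "m \<in> L2_fun M" "\<And>f. f \<in> F \<Longrightarrow> AE x in M. f x \<le> m x"
    "\<And>c. \<forall>f\<in>F. AE x in M. f x \<le> c x \<Longrightarrow> AE x in M. m x \<le> c x"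
    by blast
  have "L2_le M v (L2_class M m)" if "v \<in> A" for v
  proof -
    obtain f where "f \<in> F" "v = L2_class M f"
      using \<open>v \<in> A\<close> A_eq by blast
    then show ?thesis
      using m(1,2) by (simp add: F_def L2_le_class_iff)
  qed
  moreover have "L2_le M (L2_class M m) c" if c: "c \<in> L2 M" and c_ub: "\<forall>v\<in>A. L2_le M v c" for c
  proof -
    obtain k where k: "k \<in> L2_fun M" "c = L2_class M k"
      using c by (rule L2_cases)
    have "AE x in M. f x \<le> k x" if "f \<in> F" for f
      using that bspec[OF c_ub, of "L2_class M f"] k by (auto simp: F_def L2_le_class_iff)
    then show ?thesis
      using m(1,3) k by (simp add: L2_le_class_iff)
  qed
  ultimately show ?thesis
    using L2_class_in_L2[OF m(1)] by blast
qed

section \<open>The maximal solution as the largest subsolution\<close>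

lemma F_solutionsD:
  assumes "y \<in> F_solutions M S \<Phi> u"
  shows "y \<in> L2 M" and "S (\<Phi> y) u = y"
proof -
  have *: "y \<in> L2 M \<and> y = S (\<Phi> y) u"
    using assms unfolding F_solutions_def by (rule CollectD)
  show "y \<in> L2 M"
    using * by (rule conjunct1)
  show "S (\<Phi> y) u = y"
    by (rule sym, rule conjunct2[OF *])
qed

context qvi_setting
begin

lemma S_Phi_in_L2:
  assumes "v \<in> L2 M" "u \<in> U"
  shows "S (\<Phi> v) u \<in> L2 M"
  using S_in[OF _ assms(2)] Phi_in[OF assms(1)] by (auto simp: L2_nonneg_def)

lemma S_Phi_mono:
  assumes "v \<in> L2 M" "w \<in> L2 M" "u \<in> U" "L2_le M v w"
  shows "L2_le M (S (\<Phi> v) u) (S (\<Phi> w) u)"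
  using assms Phi_in Phi_mono by (intro S_mono) auto

lemma subsolution_max:
  assumes u: "u \<in> U" and f: "f \<in> L2_fun M" and g: "g \<in> L2_fun M"
    and "L2_le M (L2_class M f) (S (\<Phi> (L2_class M f)) u)"
    and "L2_le M (L2_class M g) (S (\<Phi> (L2_class M g)) u)"
  shows "L2_le M (L2_class M (\<lambda>x. max (f x) (g x))) (S (\<Phi> (L2_class M (\<lambda>x. max (f x) (g x)))) u)"
proof -
  let ?w = "\<lambda>x. max (f x) (g x)"
  have w: "?w \<in> L2_fun M"
    by (rule L2_fun_max[OF f g])
  obtain h where h: "h \<in> L2_fun M" "S (\<Phi> (L2_class M ?w)) u = L2_class M h"
    using S_Phi_in_L2[OF L2_class_in_L2[OF w] u] by (rule L2_cases)
  have below: "AE x in M. k x \<le> h x"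
    if k: "k \<in> L2_fun M" "L2_le M (L2_class M k) (S (\<Phi> (L2_class M k)) u)" and "\<And>x. k x \<le> ?w x" for k
  proof -
    have "L2_le M (L2_class M k) (L2_class M ?w)"
      using that by (simp add: L2_le_class_iff w)
    then have "L2_le M (S (\<Phi> (L2_class M k)) u) (L2_class M h)"
      unfolding h(2)[symmetric] by (intro S_Phi_mono L2_class_in_L2 k w u)
    with k(2) have "L2_le M (L2_class M k) (L2_class M h)"
      by (rule L2_le_trans[rotated 3]) (intro L2_class_in_L2 S_Phi_in_L2 k h u)+
    then show ?thesis
      using k h by (simp add: L2_le_class_iff)
  qed
  have "AE x in M. f x \<le> h x" "AE x in M. g x \<le> h x"
    using assms by (auto intro!: below)
  then have "AE x in M. ?w x \<le> h x"
    by eventually_elim simp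
  then show ?thesis
    using w h by (simp add: L2_le_class_iff)
qed

lemma largest_subsolution_is_fixed_point:
  assumes u: "u \<in> U"
  shows "\<exists>m\<in>F_solutions M S \<Phi> u. \<forall>v\<in>L2 M. L2_le M v (S (\<Phi> v) u) \<longrightarrow> L2_le M v m"
proof -
  define A where "A = {v \<in> L2 M. L2_le M v (S (\<Phi> v) u)}"
  have zero: "L2_class M (\<lambda>_. 0) \<in> A"
  proof -
    have "L2_class M (\<lambda>_. 0) \<in> L2 M"
      by (intro L2_class_in_L2) (simp add: L2_fun_def)
    then show ?thesis
      using S_in[OF _ u] Phi_in by (auto simp: A_def L2_nonneg_def)
  qed
  have bound: "S pbar u \<in> L2 M"
    using S_in[OF pbar_in u] by (simp add: L2_nonneg_def)
  have bounded: "L2_le M v (S pbar u)" if v: "v \<in> A" for v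
  proof -
    have "L2_le M (S (\<Phi> v) u) (S pbar u)"
      using v Phi_in[of v] by (intro S_mono pbar_in pbar_largest u) (auto simp: A_def)
    then show ?thesis
      using v L2_le_trans[OF _ S_Phi_in_L2[OF _ u] bound] by (auto simp: A_def)
  qed
  have "\<exists>m\<in>L2 M. (\<forall>v\<in>A. L2_le M v m) \<and>
    (\<forall>c\<in>L2 M. (\<forall>v\<in>A. L2_le M v c) \<longrightarrow> L2_le M m c)"
  proof (rule L2_bounded_max_closed_has_lub[of A M "S pbar u"])
    show "L2_class M (\<lambda>x. max (f x) (g x)) \<in> A"
      if "f \<in> L2_fun M" "g \<in> L2_fun M" "L2_class M f \<in> A" "L2_class M g \<in> A" for f g
      using that subsolution_max[OF u that(1,2)] L2_class_in_L2[OF L2_fun_max[OF that(1,2)]]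
      by (auto simp: A_def)
  qed (use zero bound bounded in \<open>auto simp: A_def\<close>)
  then obtain m where m: "m \<in> L2 M" "\<And>v. v \<in> A \<Longrightarrow> L2_le M v m"
    "\<And>c. c \<in> L2 M \<Longrightarrow> \<forall>v\<in>A. L2_le M v c \<Longrightarrow> L2_le M m c"
    by blast
  have Tm: "S (\<Phi> m) u \<in> L2 M"
    by (rule S_Phi_in_L2[OF m(1) u])
  have m_le: "L2_le M m (S (\<Phi> m) u)"
  proof (rule m(3)[OF Tm], rule ballI)
    fix v assume v: "v \<in> A"
    then have vL: "v \<in> L2 M" and "L2_le M v (S (\<Phi> v) u)"
      by (auto simp: A_def)
    then show "L2_le M v (S (\<Phi> m) u)"
      using S_Phi_mono[OF vL m(1) u m(2)[OF v]] L2_le_trans[OF vL S_Phi_in_L2[OF vL u] Tm] by blast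
  qed
  have "S (\<Phi> m) u \<in> A"
    using S_Phi_mono[OF m(1) Tm u m_le] Tm by (simp add: A_def)
  then have "m = S (\<Phi> m) u"
    using m(1,2) Tm m_le by (intro L2_le_antisym) auto
  then have "m \<in> F_solutions M S \<Phi> u"
    using m(1) unfolding F_solutions_def by blast
  then show ?thesis
    using m(2) unfolding A_def by blast
qed

lemma F_max_solution_greatest_subsolution:
  assumes u: "u \<in> U"
  shows "F_max_solution M S \<Phi> u \<in> F_solutions M S \<Phi> u"
    and "v \<in> L2 M \<Longrightarrow> L2_le M v (S (\<Phi> v) u) \<Longrightarrow> L2_le M v (F_max_solution M S \<Phi> u)"
proof -
  obtain m where m: "m \<in> F_solutions M S \<Phi> u"
    "\<And>v. v \<in> L2 M \<Longrightarrow> L2_le M v (S (\<Phi> v) u) \<Longrightarrow> L2_le M v m"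
    using largest_subsolution_is_fixed_point[OF u] by blast
  have largest: "L2_le M z m" if "z \<in> F_solutions M S \<Phi> u" for z
  proof (rule m(2))
    show z: "z \<in> L2 M"
      by (rule F_solutionsD(1)[OF that])
    show "L2_le M z (S (\<Phi> z) u)"
      unfolding F_solutionsD(2)[OF that] by (rule L2_le_refl[OF z])
  qed
  have "F_max_solution M S \<Phi> u = m"
    unfolding F_max_solution_def
  proof (rule the_equality)
    show "y = m" if "y \<in> F_solutions M S \<Phi> u \<and> (\<forall>z\<in>F_solutions M S \<Phi> u. L2_le M z y)" for y
    proof (rule L2_le_antisym)
      show "y \<in> L2 M" "m \<in> L2 M"
        using that m(1) by (blast dest: F_solutionsD(1))+
      show "L2_le M y m" "L2_le M m y"
        using that largest m(1) by blast+
    qed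
  qed (use m(1) largest in blast)
  then show "F_max_solution M S \<Phi> u \<in> F_solutions M S \<Phi> u"
    and "v \<in> L2 M \<Longrightarrow> L2_le M v (S (\<Phi> v) u) \<Longrightarrow> L2_le M v (F_max_solution M S \<Phi> u)"
    using m by simp_all
qed

end

section \<open>Concavity of the maximal solution\<close>

lemma lincomb_in_mem:
  assumes "convex (\<iota> ` P)" "p \<in> P" "q \<in> P" "t \<in> {0..1}"
  shows "lincomb_in P \<iota> t p (1 - t) q \<in> P"
  unfolding lincomb_in_def using assms by (intro inv_into_into convexD) auto

theorem proposition4p2:
  fixes M :: "'x measure"
    and Pbar P :: "'p set" and leP :: "'p rel" and pbar :: 'p
    and \<iota> :: "'p \<Rightarrow> 'v::real_vector"
    and U :: "'u::real_vector set"
    and S :: "'p \<Rightarrow> 'u \<Rightarrow> ('x \<Rightarrow> real) set"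
    and \<Phi> :: "('x \<Rightarrow> real) set \<Rightarrow> 'p"
  assumes setting: "qvi_setting M Pbar leP pbar U S \<Phi>"
    and P_def: "P = Pbar - {pbar}"
    and P_convex: "inj_on \<iota> P" "convex (\<iota> ` P)"
    and U_convex: "convex U"
    and S_concave: "\<And>p1 p2 u1 u2 t. p1 \<in> P \<Longrightarrow> p2 \<in> P \<Longrightarrow> u1 \<in> U \<Longrightarrow> u2 \<in> U \<Longrightarrow> t \<in> {0..1} \<Longrightarrow>
      L2_le M (L2_lincomb M t (S p1 u1) (1 - t) (S p2 u2))
        (S (lincomb_in P \<iota> t p1 (1 - t) p2) (t *\<^sub>R u1 + (1 - t) *\<^sub>R u2))"
    and Phi_concave: "\<And>v1 v2 t. v1 \<in> L2_nonneg M \<Longrightarrow> v2 \<in> L2_nonneg M \<Longrightarrow> t \<in> {0..1} \<Longrightarrow>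
      (lincomb_in P \<iota> t (\<Phi> v1) (1 - t) (\<Phi> v2), \<Phi> (L2_lincomb M t v1 (1 - t) v2)) \<in> leP"
  shows "\<forall>u1\<in>U. \<forall>u2\<in>U. \<forall>t\<in>{0..1}.
    L2_le M (L2_lincomb M t (F_max_solution M S \<Phi> u1) (1 - t) (F_max_solution M S \<Phi> u2))
      (F_max_solution M S \<Phi> (t *\<^sub>R u1 + (1 - t) *\<^sub>R u2))"
proof (intro ballI)
  fix u1 u2 and t :: real
  assume u1: "u1 \<in> U" and u2: "u2 \<in> U" and t: "t \<in> {0..1}"
  interpret qvi_setting M Pbar leP pbar U S \<Phi>
    by (rule setting)
  let ?m1 = "F_max_solution M S \<Phi> u1" and ?m2 = "F_max_solution M S \<Phi> u2"
  let ?u = "t *\<^sub>R u1 + (1 - t) *\<^sub>R u2" and ?y = "L2_lincomb M t ?m1 (1 - t) ?m2"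
  let ?p = "lincomb_in P \<iota> t (\<Phi> ?m1) (1 - t) (\<Phi> ?m2)"
  have u: "?u \<in> U"
    using U_convex u1 u2 t by (intro convexD) auto
  have m1: "?m1 \<in> L2 M" "S (\<Phi> ?m1) u1 = ?m1" and m2: "?m2 \<in> L2 M" "S (\<Phi> ?m2) u2 = ?m2"
    by (rule F_solutionsD[OF F_max_solution_greatest_subsolution(1)]; rule u1 u2)+
  have Phi1: "\<Phi> ?m1 \<in> P" and Phi2: "\<Phi> ?m2 \<in> P"
    using Phi_in m1(1) m2(1) by (auto simp: P_def)
  have nonneg: "?m1 \<in> L2_nonneg M" "?m2 \<in> L2_nonneg M"
    using S_in[of "\<Phi> ?m1" u1] S_in[of "\<Phi> ?m2" u2] Phi1 Phi2 u1 u2 m1(2) m2(2)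
    by (auto simp: P_def)
  have y: "?y \<in> L2 M"
    by (rule L2_lincomb_in_L2[OF m1(1) m2(1)])
  have p: "?p \<in> Pbar"
    using lincomb_in_mem[OF P_convex(2) Phi1 Phi2 t] by (simp add: P_def)
  have "L2_le M ?y (S ?p ?u)"
    using S_concave[OF Phi1 Phi2 u1 u2 t] by (simp only: m1(2) m2(2))
  moreover have "L2_le M (S ?p ?u) (S (\<Phi> ?y) ?u)"
    using Phi_concave[OF nonneg t] Phi_in[OF y] p u by (intro S_mono) auto
  moreover have "S ?p ?u \<in> L2 M"
    using S_in[OF p u] by (simp add: L2_nonneg_def)
  ultimately have "L2_le M ?y (S (\<Phi> ?y) ?u)"
    using L2_le_trans[OF y _ S_Phi_in_L2[OF y u]] by blast
  then show "L2_le M ?y (F_max_solution M S \<Phi> ?u)"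
    by (rule F_max_solution_greatest_subsolution(2)[OF u y])
qed

end
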